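(* For every real number $\varepsilon$ with $0<\varepsilon\le 1$, we have $B_\varepsilon\ge \frac{1}{\varepsilon}-1$.
   Context: Graphs are finite and simple. For an $n$-vertex graph $G$, a set $X\subseteq V(G)$ is a balanced separator if each component of $G-X$ has at most $2n/3$ vertices; $s(G)$ denotes the minimum size of a balanced separator in $G$. For a class $\mathcal{G}$ of graphs, $s_{\mathcal{G}}:\mathbb{N}\to\mathbb{N}$ is defined by $s_{\mathcal{G}}(n)=\max\{s(G):G\in\mathcal{G},\ |V(G)|\le n\}$. A class of graphs is hereditary if it is closed under taking induced subgraphs. For a graph $G$ and an integer $r\ge 0$, an $r$-shallow minor of $G$ is any graph obtained from a subgraph of $G$ by contracting pairwise vertex-disjoint subgraphs, each of radius at most $r$ (in particular, each connected). The density of a graph $H$ is $|E(H)|/|V(H)|$. Let $\nabla_r(G)$ be the maximum density of an $r$-shallow minor of $G$, and for a class $\mathcal{G}$ of graphs let $\nabla_{\mathcal{G}}:\mathbb{N}\to\mathbb{R}\cup\{\infty\}$ be defined by $\nabla_{\mathcal{G}}(r)=\sup\{\nabla_r(G):G\in\mathcal{G}\}$. For $0<\varepsilon\le 1$, $B_\varepsilon$ denotes the infimum of real numbers $B$ for which every hereditary class $\mathcal{G}$ of graphs such that $s_{\mathcal{G}}(n)=\Theta(n^{1-\varepsilon})$ satisfies $\nabla_{\mathcal{G}}(r)=O(r^B)$. Asymptotic notation is with respect to $n\to\infty$ and $r\to\infty$; the implied constants may depend on the class and on $\varepsilon$. *)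

theory Defs
  imports
    "HOL-Library.Landau_Symbols"
    "HOL-Library.Extended_Real"
    "HOL-Library.Disjoint_Sets"
begin

section \<open>Finite simple graphs\<close>

datatype 'a graph = Graph (verts: "'a set") (edges: "'a set set")

text \<open>The null graph (no vertices) counts as a graph.\<close>

definition simple_graph :: "'a graph \<Rightarrow> bool" where
  "simple_graph G \<longleftrightarrow>
     finite (verts G) \<and> edges G \<subseteq> {e. e \<subseteq> verts G \<and> card e = 2}"

definition subgraph :: "'a graph \<Rightarrow> 'a graph \<Rightarrow> bool" where
  "subgraph H G \<longleftrightarrow>
     simple_graph H \<and> verts H \<subseteq> verts G \<and> edges H \<subseteq> edges G"

definition induced :: "'a graph \<Rightarrow> 'a set \<Rightarrow> 'a graph" where
  "induced G X = Graph X {e \<in> edges G. e \<subseteq> X}"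

definition graph_iso :: "'a graph \<Rightarrow> 'b graph \<Rightarrow> bool" where
  "graph_iso G H \<longleftrightarrow>
     (\<exists>f. bij_betw f (verts G) (verts H) \<and>
          (\<forall>u\<in>verts G. \<forall>v\<in>verts G. {u, v} \<in> edges G \<longleftrightarrow> {f u, f v} \<in> edges H))"

definition adj :: "'a graph \<Rightarrow> ('a \<times> 'a) set" where
  "adj G = {(u, v). {u, v} \<in> edges G}"

text \<open>The vertex sets of the connected components.\<close>

definition components :: "'a graph \<Rightarrow> 'a set set" where
  "components G = {{v \<in> verts G. (u, v) \<in> (adj G)\<^sup>*} | u. u \<in> verts G}"

text \<open>Distances are \<open>\<infinity>\<close> between different components; hence a graph of finite
  radius is connected, and the null graph has radius \<open>\<infinity>\<close>.\<close>

definition gdist :: "'a graph \<Rightarrow> 'a \<Rightarrow> 'a \<Rightarrow> enat" where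
  "gdist G u v = (INF k \<in> {k. (u, v) \<in> adj G ^^ k}. enat k)"

definition radius :: "'a graph \<Rightarrow> enat" where
  "radius G = (INF u \<in> verts G. SUP v \<in> verts G. gdist G u v)"


section \<open>Balanced separators\<close>

definition balanced_separator :: "'a graph \<Rightarrow> 'a set \<Rightarrow> bool" where
  "balanced_separator G X \<longleftrightarrow>
     X \<subseteq> verts G \<and>
     (\<forall>C \<in> components (induced G (verts G - X)).
        real (card C) \<le> 2 * real (card (verts G)) / 3)"

definition sep_number :: "'a graph \<Rightarrow> nat" where
  "sep_number G = Min (card ` {X. balanced_separator G X})"


section \<open>Shallow minors\<close>

text \<open>Contracting a family of pairwise vertex-disjoint subgraphs: each vertex of the
  result is the set of vertices that is identified to form it, and loops and parallel
  edges are suppressed.\<close>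

definition bags :: "'a graph \<Rightarrow> 'a graph set \<Rightarrow> 'a set set" where
  "bags G \<F> = verts ` \<F> \<union> {{v} | v. v \<in> verts G - \<Union> (verts ` \<F>)}"

definition contract :: "'a graph \<Rightarrow> 'a graph set \<Rightarrow> 'a set graph" where
  "contract G \<F> = Graph (bags G \<F>)
     {{A, B} | A B. A \<in> bags G \<F> \<and> B \<in> bags G \<F> \<and> A \<noteq> B \<and>
                    (\<exists>a\<in>A. \<exists>b\<in>B. {a, b} \<in> edges G)}"

definition shallow_minors :: "nat \<Rightarrow> 'a graph \<Rightarrow> 'a set graph set" where
  "shallow_minors r G =
     {contract H \<F> | H \<F>. subgraph H G \<and> (\<forall>F\<in>\<F>. subgraph F H \<and> radius F \<le> enat r) \<and>
                      disjoint_family_on verts \<F>}"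

text \<open>The density of the null graph is \<open>0 / 0 = 0\<close>.\<close>

definition density :: "'a graph \<Rightarrow> real" where
  "density G = real (card (edges G)) / real (card (verts G))"

definition nabla :: "nat \<Rightarrow> 'a graph \<Rightarrow> real" where
  "nabla r G = Max (density ` shallow_minors r G)"


section \<open>Graph classes\<close>

text \<open>Every finite graph is isomorphic to one whose vertices are natural numbers, so a
  class of graphs is an isomorphism-closed set of such graphs.\<close>

definition graph_class :: "nat graph set \<Rightarrow> bool" where
  "graph_class \<G> \<longleftrightarrow>
     (\<forall>G\<in>\<G>. simple_graph G) \<and>
     (\<forall>G\<in>\<G>. \<forall>H. simple_graph H \<and> graph_iso G H \<longrightarrow> H \<in> \<G>)"

definition hereditary :: "nat graph set \<Rightarrow> bool" where
  "hereditary \<G> \<longleftrightarrow> (\<forall>G\<in>\<G>. \<forall>X. X \<subseteq> verts G \<longrightarrow> induced G X \<in> \<G>)"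

definition class_sep :: "nat graph set \<Rightarrow> nat \<Rightarrow> nat" where
  "class_sep \<G> n = Max {sep_number G | G. G \<in> \<G> \<and> card (verts G) \<le> n}"

definition class_nabla :: "nat graph set \<Rightarrow> nat \<Rightarrow> ereal" where
  "class_nabla \<G> r = (SUP G \<in> \<G>. ereal (nabla r G))"

text \<open>\<open>class_nabla \<G> r = O(r\<^sup>B)\<close>; as the left-hand side may be infinite, the
  bound is stated directly in the extended reals.\<close>

definition nabla_bigo :: "nat graph set \<Rightarrow> real \<Rightarrow> bool" where
  "nabla_bigo \<G> B \<longleftrightarrow>
     (\<exists>c::real. \<forall>\<^sub>F r in sequentially. class_nabla \<G> r \<le> ereal (c * real r powr B))"

text \<open>The infimum is taken in the extended reals, so that it is \<open>\<infinity>\<close> if there is no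
  admissible exponent.\<close>

definition B_exp :: "real \<Rightarrow> ereal" where
  "B_exp \<epsilon> = Inf (ereal ` {B. \<forall>\<G>. graph_class \<G> \<and> hereditary \<G> \<and>
       (\<lambda>n. real (class_sep \<G> n)) \<in> \<Theta>(\<lambda>n. real n powr (1 - \<epsilon>)) \<longrightarrow> nabla_bigo \<G> B})"


section \<open>The extrema above range over finite nonempty sets\<close>

lemma balanced_separator_verts: "balanced_separator G (verts G)"
  by (simp add: balanced_separator_def induced_def components_def)

lemma finite_balanced_separators:
  "simple_graph G \<Longrightarrow> finite {X. balanced_separator G X}"
  by (rule finite_subset[of _ "Pow (verts G)"])
     (auto simp: balanced_separator_def simple_graph_def)

lemma sep_number_le:
  assumes "simple_graph G"
  shows "sep_number G \<le> card (verts G)"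
  unfolding sep_number_def using finite_balanced_separators[OF assms] balanced_separator_verts
  by (intro Min_le) auto

lemma finite_class_sep:
  assumes "graph_class \<G>"
  shows "finite {sep_number G | G. G \<in> \<G> \<and> card (verts G) \<le> n}"
proof (rule finite_subset)
  show "{sep_number G | G. G \<in> \<G> \<and> card (verts G) \<le> n} \<subseteq> {..n}"
    using assms sep_number_le by (fastforce simp: graph_class_def intro: order_trans)
qed simp

lemma nonempty_class_sep:
  assumes "hereditary \<G>" "\<G> \<noteq> {}"
  shows "{sep_number G | G. G \<in> \<G> \<and> card (verts G) \<le> n} \<noteq> {}"
proof -
  obtain G where "G \<in> \<G>" using assms(2) by blast
  then have "induced G {} \<in> \<G>" using assms(1) by (simp add: hereditary_def)
  moreover have "card (verts (induced G {})) \<le> n" by (simp add: induced_def)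
  ultimately show ?thesis by blast
qed

lemma finite_shallow_minors:
  assumes "simple_graph G"
  shows "finite (shallow_minors r G)"
proof -
  have fin: "finite (verts G)" using assms by (simp add: simple_graph_def)
  have "finite (edges G)"
    by (rule finite_subset[of _ "Pow (verts G)"]) (use assms fin in \<open>auto simp: simple_graph_def\<close>)
  define S where "S = case_prod Graph ` (Pow (verts G) \<times> Pow (edges G))"
  have "finite S" unfolding S_def using fin \<open>finite (edges G)\<close> by simp
  have S: "H \<in> S" if "subgraph H G" for H
  proof -
    have "H = case_prod Graph (verts H, edges H)" by simp
    moreover have "(verts H, edges H) \<in> Pow (verts G) \<times> Pow (edges G)"
      using that by (simp add: subgraph_def)
    ultimately show ?thesis unfolding S_def by (rule image_eqI)
  qed
  have "shallow_minors r G \<subseteq> case_prod contract ` (S \<times> Pow S)"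
  proof
    fix M assume "M \<in> shallow_minors r G"
    then obtain H \<F> where M: "M = contract H \<F>" "subgraph H G" "\<forall>F\<in>\<F>. subgraph F H"
      unfolding shallow_minors_def by blast
    have "subgraph F G" if "F \<in> \<F>" for F
      using M that unfolding subgraph_def by blast
    then have "\<F> \<subseteq> S" using S by blast
    with M S show "M \<in> case_prod contract ` (S \<times> Pow S)" by force
  qed
  then show ?thesis using \<open>finite S\<close> by (meson finite_SigmaI finite_Pow_iff finite_imageI finite_subset)
qed

lemma nonempty_shallow_minors:
  assumes "simple_graph G"
  shows "shallow_minors r G \<noteq> {}"
proof -
  have "contract G {} \<in> shallow_minors r G"
    unfolding shallow_minors_def using assms
    by (auto simp: subgraph_def disjoint_family_on_def)
  then show ?thesis by blast
qed

end

theory Submission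
  imports Defs "HOL-Library.Countable" "HOL-Library.FuncSet"
begin

text \<open>
  Fix \<open>b = 1 / \<epsilon> - 1\<close> and consider all induced subgraphs of graphs obtained from a complete
  multigraph on \<open>m \<le> 2 l\<^sup>b\<close> branch vertices by replacing every edge by a path with \<open>l\<close> inner
  vertices.

  A graph with \<open>n\<close> vertices in this class contains at most \<open>m\<close> branch vertices and at most
  \<open>n / l\<close> complete subdivided edges; deleting either all branch vertices or one vertex of each
  complete subdivided edge leaves a forest, and two further vertices suffice to balance it. Since \<open>min m (n / l) \<le> 2 n\<^bsup>1 - \<epsilon>\<^esup>\<close>, the
  separator number is \<open>O(n\<^bsup>1 - \<epsilon>\<^esup>)\<close>. A subdivided expander of bounded average degree on
  \<open>m = \<Theta>(l\<^sup>b)\<close> branch vertices has \<open>n = \<Theta>(l\<^bsup>1 / \<epsilon>\<^esup>)\<close> vertices and separator number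
  \<open>\<Omega>(m) = \<Omega>(n\<^bsup>1 - \<epsilon>\<^esup>)\<close>. Contracting balls of radius \<open>r = l / 2\<close> around the branch vertices
  yields a clique of order \<open>\<Theta>(r\<^sup>b)\<close>, so the exponent of \<open>\<nabla>\<close> is at least \<open>b\<close>.
\<close>

section \<open>Separators of subdivided multigraphs\<close>

lemma component_label_constant:
  assumes "C \<in> components G" and "\<And>u v. {u, v} \<in> edges G \<Longrightarrow> \<phi> u = \<phi> v"
  obtains a where "C \<subseteq> {v \<in> verts G. \<phi> v = a}"
proof -
  obtain u where C: "C = {v \<in> verts G. (u, v) \<in> (adj G)\<^sup>*}"
    using assms(1) by (auto simp: components_def)
  have "\<phi> v = \<phi> u" if "(u, v) \<in> (adj G)\<^sup>*" for v
    using that by induction (use assms(2) in \<open>auto simp: adj_def\<close>)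
  with C have "C \<subseteq> {v \<in> verts G. \<phi> v = \<phi> u}" by blast
  then show thesis by (rule that)
qed

text \<open>All upper bounds on separators go through this criterion. A label class may be a union
  of components, so a coarse labelling that is easy to count suffices.\<close>

lemma balanced_separator_labelling:
  assumes "simple_graph G" "X \<subseteq> verts G"
    and "\<And>u v. \<lbrakk>u \<in> verts G - X; v \<in> verts G - X; {u, v} \<in> edges G\<rbrakk> \<Longrightarrow> \<phi> u = \<phi> v"
    and "\<And>a. 3 * card {v \<in> verts G - X. \<phi> v = a} \<le> 2 * card (verts G)"
  shows "balanced_separator G X"
  unfolding balanced_separator_def
proof (intro conjI ballI)
  fix C assume "C \<in> components (induced G (verts G - X))"
  then obtain a where "C \<subseteq> {v \<in> verts G - X. \<phi> v = a}"
    by (rule component_label_constant[where \<phi> = \<phi>])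
      (use assms(3) in \<open>auto simp: induced_def\<close>)
  then have "card C \<le> card {v \<in> verts G - X. \<phi> v = a}"
    using assms(1) by (intro card_mono) (auto simp: simple_graph_def)
  with assms(4)[of a] show "real (card C) \<le> 2 * real (card (verts G)) / 3" by linarith
qed (fact assms(2))

lemma sep_number_le_card:
  assumes "simple_graph G" "balanced_separator G X"
  shows "sep_number G \<le> card X"
  unfolding sep_number_def using assms finite_balanced_separators by (intro Min_le) auto

text \<open>
  The arc \<open>(i, j, c)\<close> is the \<open>c\<close>-th parallel edge from \<open>i\<close> to \<open>j\<close> (loops are allowed), and
  \<open>Inner e 0, \<dots>, Inner e (l - 1)\<close> is the path replacing the arc \<open>e\<close>.
\<close>

datatype vertex = Branch nat | Inner "nat \<times> nat \<times> nat" nat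

instance vertex :: countable by countable_datatype

abbreviation src :: "nat \<times> nat \<times> nat \<Rightarrow> nat" where "src e \<equiv> fst e"
abbreviation tgt :: "nat \<times> nat \<times> nat \<Rightarrow> nat" where "tgt e \<equiv> fst (snd e)"

text \<open>Branch vertices are never linked to each other and parallel arcs have different inner
  vertices, so the relation is symmetric and irreflexive even for loops and short paths: it always
  describes a simple graph.\<close>

fun link :: "nat \<Rightarrow> vertex \<Rightarrow> vertex \<Rightarrow> bool" where
  "link l (Branch i) (Branch j) = False"
| "link l (Branch i) (Inner e t) = (i = src e \<and> t = 0 \<or> i = tgt e \<and> Suc t = l)"
| "link l (Inner e t) (Branch i) = (i = src e \<and> t = 0 \<or> i = tgt e \<and> Suc t = l)"
| "link l (Inner e t) (Inner e' t') = (e = e' \<and> (t' = Suc t \<or> t = Suc t'))"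

text \<open>The third component of an arc, its multiplicity index, is unbounded. The set is infinite
  for positive \<open>m\<close> and \<open>l\<close>; the graphs of the class live on its finite
  subsets.\<close>

definition host_verts :: "nat \<Rightarrow> nat \<Rightarrow> vertex set" where
  "host_verts m l = {Branch i | i. i < m} \<union> {Inner e t | e t. src e < m \<and> tgt e < m \<and> t < l}"

text \<open>An induced subgraph of the host up to isomorphism. Keeping the map \<open>\<pi>\<close>
  reduces closure under isomorphism and under induced subgraphs to composing or restricting
  it.\<close>

definition embedding :: "nat \<Rightarrow> nat \<Rightarrow> ('a \<Rightarrow> vertex) \<Rightarrow> 'a graph \<Rightarrow> bool" where
  "embedding m l \<pi> G \<longleftrightarrow> simple_graph G \<and> inj_on \<pi> (verts G) \<and> \<pi> ` verts G \<subseteq> host_verts m l \<and>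
     (\<forall>u\<in>verts G. \<forall>v\<in>verts G. {u, v} \<in> edges G \<longleftrightarrow> link l (\<pi> u) (\<pi> v))"

section \<open>Counting in finite sets\<close>

lemma card_filter_split:
  assumes "finite A"
  shows "card {x \<in> A. P x} + card {x \<in> A. \<not> P x} = card A"
proof -
  have "card ({x \<in> A. P x} \<union> {x \<in> A. \<not> P x}) = card {x \<in> A. P x} + card {x \<in> A. \<not> P x}"
    using assms by (intro card_Un_disjoint) auto
  moreover have "{x \<in> A. P x} \<union> {x \<in> A. \<not> P x} = A" by blast
  ultimately show ?thesis by simp
qed

text \<open>Take the least element of \<open>T\<close> with at least half of \<open>T\<close> at or
  below it. If at least half lay strictly below, its predecessor in \<open>T\<close> would qualify
  already.\<close>

lemma median_nat:
  fixes T :: "nat set"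
  assumes "finite T" "T \<noteq> {}"
  obtains s where "s \<in> T" "2 * card {t \<in> T. t < s} \<le> card T" "2 * card {t \<in> T. s < t} \<le> card T"
proof -
  let ?Q = "\<lambda>s. s \<in> T \<and> card T \<le> 2 * card {t \<in> T. t \<le> s}"
  have "{t \<in> T. t \<le> Max T} = T" using assms by auto
  then have "?Q (Max T)" using assms by simp
  define s where "s = (LEAST s. ?Q s)"
  have Q: "?Q s" unfolding s_def by (rule LeastI) fact
  have min: "\<not> ?Q s'" if "s' < s" for s' using that not_less_Least unfolding s_def by blast
  have split: "card T = card {t \<in> T. t \<le> s} + card {t \<in> T. s < t}"
    using card_filter_split[OF assms(1), of "\<lambda>t. t \<le> s"] by (simp add: not_le)
  have "2 * card {t \<in> T. t < s} \<le> card T"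
  proof (cases "{t \<in> T. t < s} = {}")
    case False
    define s' where "s' = Max {t \<in> T. t < s}"
    have s': "s' \<in> T" "s' < s" using Max_in[OF _ False] assms unfolding s'_def by auto
    have "t \<le> s'" if "t \<in> T" "t < s" for t
      unfolding s'_def using that assms by (intro Max_ge) auto
    then have "{t \<in> T. t \<le> s'} = {t \<in> T. t < s}" using s' by auto
    with min[of s'] s' show ?thesis by simp
  next
    case True
    then show ?thesis by (simp only: card.empty)
  qed
  with Q split that show thesis by fastforce
qed

text \<open>
  Every path that is not complete in \<open>G - X\<close> is cut at a missing vertex, and each of its remaining
  inner vertices is labelled with the end of the path on its side of the cut. If one label class
  is too large, delete its branch vertex, which leaves pieces of single paths; if one of these is
  still too large, delete its median.
\<close>

lemma sep_number_subdivision_le: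
  assumes emb: "embedding m l \<pi> G" and X: "X \<subseteq> verts G"
    and cuts: "\<And>e. Branch (src e) \<in> \<pi> ` (verts G - X) \<Longrightarrow> Branch (tgt e) \<in> \<pi> ` (verts G - X) \<Longrightarrow>
      \<exists>t<l. Inner e t \<notin> \<pi> ` (verts G - X)"
  shows "sep_number G \<le> card X + 2"
proof -
  define V where "V = verts G"
  define W where "W = \<pi> ` (V - X)"
  have sg: "simple_graph G" and inj: "inj_on \<pi> V" and host: "\<pi> ` V \<subseteq> host_verts m l"
    and edge: "\<And>u v. u \<in> V \<Longrightarrow> v \<in> V \<Longrightarrow> {u, v} \<in> edges G \<longleftrightarrow> link l (\<pi> u) (\<pi> v)"
    using emb by (auto simp: embedding_def V_def)
  have finV: "finite V" using sg by (simp add: simple_graph_def V_def)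
  have XV: "X \<subseteq> V" using X by (simp add: V_def)
  have Wt: "t < l" if "Inner e t \<in> W" for e t
    using that host unfolding W_def host_verts_def by fastforce
  have cuts': "Branch (src e) \<notin> W \<or> Branch (tgt e) \<notin> W \<or> (\<exists>k<l. Inner e k \<notin> W)" for e
    using cuts[of e] unfolding W_def V_def by blast
  \<comment> \<open>Position \<open>0\<close> covers a missing source or a missing first inner
    vertex, position \<open>l\<close> a missing target. With \<open>cut e = 0\<close> all present
    inner vertices go to the target, with \<open>cut e = l\<close> all go to the source.\<close>
  have "\<forall>e. \<exists>k. (k = 0 \<and> Branch (src e) \<notin> W) \<or> (k = l \<and> Branch (tgt e) \<notin> W) \<or>
      (k < l \<and> Inner e k \<notin> W)"
  proof
    fix e
    show "\<exists>k. (k = 0 \<and> Branch (src e) \<notin> W) \<or> (k = l \<and> Branch (tgt e) \<notin> W) \<or>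
      (k < l \<and> Inner e k \<notin> W)"
      using cuts'[of e] by fast
  qed
  then obtain cut where cut: "\<And>e. (cut e = 0 \<and> Branch (src e) \<notin> W) \<or>
      (cut e = l \<and> Branch (tgt e) \<notin> W) \<or> (cut e < l \<and> Inner e (cut e) \<notin> W)"
    unfolding choice_iff by blast
  define \<psi> where "\<psi> x = (case x of Branch i \<Rightarrow> i | Inner e t \<Rightarrow> if t < cut e then src e else tgt e)" for x
  have \<psi>: "\<psi> x = \<psi> y" if "x \<in> W" "y \<in> W" "link l x y" for x y
  proof -
    have BI: "\<psi> (Branch i) = \<psi> (Inner e t)"
      if "Branch i \<in> W" "Inner e t \<in> W" "link l (Branch i) (Inner e t)" for i e t
    proof -
      have "t < cut e" if "i = src e" "t = 0"
        using that cut[of e] \<open>Branch i \<in> W\<close> \<open>Inner e t \<in> W\<close> Wt[of e t] by (cases "cut e = 0") auto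
      moreover have "\<not> t < cut e" if "i = tgt e" "Suc t = l"
        using that cut[of e] \<open>Branch i \<in> W\<close> \<open>Inner e t \<in> W\<close> by (cases "cut e = t") auto
      ultimately show ?thesis
        using that(3) by (auto simp: \<psi>_def)
    qed
    \<comment> \<open>Labels could change only if \<open>cut e = Suc t\<close>. That position is
      neither \<open>0\<close> nor \<open>l\<close>, so the vertex there would be missing.\<close>
    have II: "\<psi> (Inner e t) = \<psi> (Inner e (Suc t))"
      if "Inner e t \<in> W" "Inner e (Suc t) \<in> W" for e t
    proof -
      have "cut e \<noteq> Suc t" using that cut[of e] Wt[of e "Suc t"] by auto
      then show ?thesis by (auto simp: \<psi>_def)
    qed
    show ?thesis
    proof (cases x; cases y)
      fix i j assume "x = Branch i" "y = Branch j"
      then show ?thesis using that by simp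
    next
      fix i e t assume "x = Branch i" "y = Inner e t"
      then show ?thesis using that BI by blast
    next
      fix i e t assume "x = Inner e t" "y = Branch i"
      then show ?thesis using that BI[of i e t] by simp
    next
      fix e t e' t' assume "x = Inner e t" "y = Inner e' t'"
      then show ?thesis using that II[of e t] II[of e t'] by auto
    qed
  qed
  define n where "n = card V"
  \<comment> \<open>\<open>Inl\<close> keeps the labels outside the class of \<open>i\<close>;
    inside it, \<open>Inr e\<close> groups the vertices by path. The value at
    \<open>Branch i\<close> is a default, as that vertex gets deleted.\<close>
  define lab where "lab i x = (if \<psi> x \<noteq> i then Inl (\<psi> x) else
     (case x of Branch _ \<Rightarrow> Inl i | Inner e t \<Rightarrow> Inr e))" for i x
  have sep: "sep_number G \<le> card Y"
    if "Y \<subseteq> V" "\<And>u v. \<lbrakk>u \<in> V - Y; v \<in> V - Y; {u, v} \<in> edges G\<rbrakk> \<Longrightarrow> \<phi> u = \<phi> v"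
      "\<And>a. 3 * card {v \<in> V - Y. \<phi> v = a} \<le> 2 * n" for Y and \<phi> :: "'a \<Rightarrow> 'c"
    using balanced_separator_labelling[of G Y \<phi>] sep_number_le_card[OF sg] that sg
    unfolding V_def n_def by blast
  show ?thesis
  proof (cases "\<forall>a. 3 * card {v \<in> V - X. \<psi> (\<pi> v) = a} \<le> 2 * n")
    case True
    have "sep_number G \<le> card X"
      by (rule sep[of X "\<lambda>v. \<psi> (\<pi> v)"]) (use XV True \<psi> edge in \<open>auto simp: W_def\<close>)
    then show ?thesis by simp
  next
    case False
    then obtain i where i: "2 * n < 3 * card {v \<in> V - X. \<psi> (\<pi> v) = i}" by (auto simp: not_le)
    have "card {v \<in> V - X. \<psi> (\<pi> v) = i} + card {v \<in> V - X. \<psi> (\<pi> v) \<noteq> i} = card (V - X)"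
      using finV by (intro card_filter_split) auto
    moreover have "card (V - X) \<le> n" unfolding n_def using finV by (intro card_mono) auto
    ultimately have rest: "3 * card {v \<in> V - X. \<psi> (\<pi> v) \<noteq> i} \<le> n" using i by linarith
    define Y where "Y = X \<union> {v \<in> V. \<pi> v = Branch i}"
    have "card {v \<in> V. \<pi> v = Branch i} \<le> 1"
      using inj finV by (auto simp: card_le_Suc0_iff_eq inj_on_def)
    then have cY: "card Y \<le> card X + 1" unfolding Y_def using card_Un_le[of X] by (meson add_left_mono order_trans)
    have YV: "Y \<subseteq> V" "X \<subseteq> Y" using XV by (auto simp: Y_def)
    have lab: "lab i (\<pi> u) = lab i (\<pi> v)" if "u \<in> V - Y" "v \<in> V - Y" "{u, v} \<in> edges G" for u v
    proof -
      have "\<pi> u \<in> W" "\<pi> v \<in> W" "link l (\<pi> u) (\<pi> v)" "\<pi> u \<noteq> Branch i" "\<pi> v \<noteq> Branch i"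
        using that edge by (auto simp: W_def Y_def)
      with \<psi>[of "\<pi> u" "\<pi> v"] show ?thesis
        by (cases "\<pi> u"; cases "\<pi> v") (auto simp: lab_def \<psi>_def)
    qed
    \<comment> \<open>With \<open>Branch i\<close> gone, \<open>Inl\<close> labels occur only
      outside the large class, that is, on at most a third of all vertices.\<close>
    have small: "3 * card {v \<in> V - Y'. lab i (\<pi> v) = Inl a} \<le> 2 * n" if "Y \<subseteq> Y'" for Y' a
    proof -
      have "{v \<in> V - Y'. lab i (\<pi> v) = Inl a} \<subseteq> {v \<in> V - X. \<psi> (\<pi> v) \<noteq> i}"
      proof
        fix v assume v: "v \<in> {v \<in> V - Y'. lab i (\<pi> v) = Inl a}"
        then have "\<pi> v \<noteq> Branch i" using that by (auto simp: Y_def)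
        moreover have "\<psi> (\<pi> v) \<noteq> i \<or> \<pi> v = Branch (\<psi> (\<pi> v))"
          using v by (cases "\<pi> v") (auto simp: lab_def \<psi>_def)
        ultimately show "v \<in> {v \<in> V - X. \<psi> (\<pi> v) \<noteq> i}" using v that YV by auto
      qed
      then have "card {v \<in> V - Y'. lab i (\<pi> v) = Inl a} \<le> card {v \<in> V - X. \<psi> (\<pi> v) \<noteq> i}"
        using finV by (intro card_mono) auto
      with rest show ?thesis by linarith
    qed
    show ?thesis
    proof (cases "\<forall>e. 3 * card {v \<in> V - Y. lab i (\<pi> v) = Inr e} \<le> 2 * n")
      case True
      have "3 * card {v \<in> V - Y. lab i (\<pi> v) = a} \<le> 2 * n" for a
        using True small[of Y] by (cases a) auto
      then have "sep_number G \<le> card Y"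
        using sep[of Y "\<lambda>v. lab i (\<pi> v)"] YV lab by blast
      with cY show ?thesis by simp
    next
      case False
      then obtain e where e: "2 * n < 3 * card {v \<in> V - Y. lab i (\<pi> v) = Inr e}"
        by (auto simp: not_le)
      define F where "F = {v \<in> V - Y. lab i (\<pi> v) = Inr e}"
      \<comment> \<open>The value at branch vertices is a default: \<open>F\<close> consists of
        inner vertices of the path \<open>e\<close>.\<close>
      define pos where "pos v = (case \<pi> v of Branch _ \<Rightarrow> 0 | Inner _ t \<Rightarrow> t)" for v
      have \<pi>F: "\<pi> v = Inner e (pos v)" if "v \<in> F" for v
        using that by (auto simp: F_def lab_def pos_def split: vertex.splits if_splits)
      have finF: "finite F" using finV by (auto simp: F_def)
      have injF: "inj_on pos F"
      proof (rule inj_onI)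
        fix u v assume "u \<in> F" "v \<in> F" "pos u = pos v"
        with \<pi>F[of u] \<pi>F[of v] have "\<pi> u = \<pi> v" by simp
        with \<open>u \<in> F\<close> \<open>v \<in> F\<close> show "u = v" using inj by (auto simp: F_def dest: inj_onD)
      qed
      have "F \<noteq> {}" using e unfolding F_def[symmetric] by auto
      then obtain s where s: "s \<in> pos ` F" "2 * card {t \<in> pos ` F. t < s} \<le> card (pos ` F)"
          "2 * card {t \<in> pos ` F. s < t} \<le> card (pos ` F)"
        using median_nat[of "pos ` F"] finF by blast
      have cF: "card F \<le> n" unfolding n_def F_def using finV by (intro card_mono) auto
      have card_pos: "card {v \<in> F. P (pos v)} = card {t \<in> pos ` F. P t}" for P
      proof -
        have "{t \<in> pos ` F. P t} = pos ` {v \<in> F. P (pos v)}" by auto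
        then show ?thesis
          using card_image[OF inj_on_subset[OF injF, of "{v \<in> F. P (pos v)}"]] by auto
      qed
      obtain w where w: "w \<in> F" "pos w = s" using s by auto
      define Z where "Z = insert w Y"
      \<comment> \<open>The second component splits the oversized piece at its median into parts of
        at most \<open>n / 2\<close> vertices. Every other path label lies outside \<open>F\<close>
        and so has fewer than \<open>n / 3\<close>.\<close>
      define lab' where "lab' v = (lab i (\<pi> v), lab i (\<pi> v) = Inr e \<and> pos v < s)" for v
      have ZV: "Z \<subseteq> V" using w YV by (auto simp: Z_def F_def)
      have lab': "lab' u = lab' v" if "u \<in> V - Z" "v \<in> V - Z" "{u, v} \<in> edges G" for u v
      proof -
        have eq: "lab i (\<pi> u) = lab i (\<pi> v)" using lab that by (auto simp: Z_def)
        have "pos u < s \<longleftrightarrow> pos v < s" if "lab i (\<pi> u) = Inr e"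
        proof -
          have F: "u \<in> F" "v \<in> F" using that eq \<open>u \<in> V - Z\<close> \<open>v \<in> V - Z\<close> by (auto simp: F_def Z_def)
          have "pos u \<noteq> s" "pos v \<noteq> s"
            using F w inj_onD[OF injF, of u w] inj_onD[OF injF, of v w] \<open>u \<in> V - Z\<close> \<open>v \<in> V - Z\<close>
            by (auto simp: Z_def)
          moreover have "link l (\<pi> u) (\<pi> v)"
            using edge \<open>u \<in> V - Z\<close> \<open>v \<in> V - Z\<close> \<open>{u, v} \<in> edges G\<close> by blast
          then have "pos v = Suc (pos u) \<or> pos u = Suc (pos v)"
            using \<pi>F[OF F(1)] \<pi>F[OF F(2)] by (metis link.simps(4))
          ultimately show ?thesis by linarith
        qed
        with eq show ?thesis by (auto simp: lab'_def)
      qed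
      have "3 * card {v \<in> V - Z. lab' v = a} \<le> 2 * n" for a
      proof (cases "fst a")
        case (Inl j)
        have "card {v \<in> V - Z. lab' v = a} \<le> card {v \<in> V - Z. lab i (\<pi> v) = Inl j}"
          using finV Inl by (intro card_mono) (auto simp: lab'_def)
        moreover have "Y \<subseteq> Z" by (auto simp: Z_def)
        ultimately show ?thesis using small[of Z j] by linarith
      next
        case (Inr e')
        show ?thesis
        proof (cases "e' = e")
          case True
          have sub: "{v \<in> V - Z. lab' v = a} \<subseteq>
            (if snd a then {v \<in> F. pos v < s} else {v \<in> F. s < pos v})"
          proof
            fix v assume v: "v \<in> {v \<in> V - Z. lab' v = a}"
            then have vF: "v \<in> F" using Inr True by (auto simp: F_def Z_def lab'_def)
            have "pos v \<noteq> s" using vF w inj_onD[OF injF, of v w] v by (auto simp: Z_def)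
            with v vF show "v \<in> (if snd a then {v \<in> F. pos v < s} else {v \<in> F. s < pos v})"
              using Inr True by (auto simp: lab'_def)
          qed
          have "2 * card (if snd a then {v \<in> F. pos v < s} else {v \<in> F. s < pos v}) \<le> card F"
            using s card_pos[of "\<lambda>t. t < s"] card_pos[of "\<lambda>t. s < t"] card_image[OF injF] by auto
          moreover have "card {v \<in> V - Z. lab' v = a} \<le>
            card (if snd a then {v \<in> F. pos v < s} else {v \<in> F. s < pos v})"
            using finF by (intro card_mono sub) auto
          ultimately show ?thesis using cF by linarith
        next
          case False
          have "card {v \<in> V - Z. lab' v = a} \<le> card (V - F)"
            using finV Inr False by (intro card_mono) (auto simp: lab'_def F_def)
          also have "\<dots> = n - card F"
            unfolding n_def using finF by (intro card_Diff_subset) (auto simp: F_def)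
          finally show ?thesis using e unfolding F_def[symmetric] by linarith
        qed
      qed
      then have "sep_number G \<le> card Z"
        using sep[of Z lab'] ZV lab' by blast
      also have "\<dots> \<le> card Y + 1" unfolding Z_def by (simp add: card_insert_le_m1 card_insert_if YV finV finite_subset[OF YV(1) finV])
      finally show ?thesis using cY by simp
    qed
  qed
qed

section \<open>Subdivided expanders\<close>

text \<open>
  Union bound over all \<open>(A, B)\<close>: a fraction of at most \<open>(9 / 10)\<^bsup>200 m / 10\<^esup> \<le> 8\<^bsup>-m\<^esup>\<close> of all
  families \<open>f\<close> avoids a given pair, and there are at most \<open>4\<^sup>m\<close> pairs.
\<close>

lemma expanding_functions:
  assumes "m \<ge> 1"
  obtains f :: "nat \<Rightarrow> nat \<Rightarrow> nat"
  where "\<And>c i. c < 200 \<Longrightarrow> i < m \<Longrightarrow> f c i < m"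
    and "\<And>A B. \<lbrakk>A \<subseteq> {..<m}; B \<subseteq> {..<m}; m \<le> 10 * card A; m \<le> 10 * card B\<rbrakk> \<Longrightarrow>
      \<exists>c<200. \<exists>a\<in>A. f c a \<in> B"
proof -
  define I where "I = {..<200::nat} \<times> {..<m}"
  define \<Omega> where "\<Omega> = I \<rightarrow>\<^sub>E {..<m}"
  \<comment> \<open>The families none of whose 200 functions sends an element of \<open>A\<close>
    into \<open>B\<close>.\<close>
  define bad where "bad A B = PiE I (\<lambda>(c, a). if a \<in> A then {..<m} - B else {..<m})" for A B
  define S where "S = {(A, B). A \<subseteq> {..<m} \<and> B \<subseteq> {..<m} \<and> m \<le> 10 * card A \<and> m \<le> 10 * card B}"
  have finI: "finite I" by (simp add: I_def)
  have card\<Omega>: "real (card \<Omega>) = real m ^ (200 * m)"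
    unfolding \<Omega>_def using finI by (simp add: card_PiE I_def)
  have card_bad: "real (card (bad A B)) \<le> real m ^ (200 * m) * (1 / 8) ^ m" if "(A, B) \<in> S" for A B
  proof -
    have AB: "A \<subseteq> {..<m}" "B \<subseteq> {..<m}" "m \<le> 10 * card A" "m \<le> 10 * card B"
      using that by (auto simp: S_def)
    have "card ({..<m} - B) = m - card B"
      using AB finite_subset by (subst card_Diff_subset) auto
    then have cB: "real (card ({..<m} - B)) \<le> real m * (9 / 10)"
      using AB by linarith
    have "real (card (bad A B)) =
        (\<Prod>(c, a)\<in>I. real (card (if a \<in> A then {..<m} - B else {..<m})))"
      unfolding bad_def by (subst card_PiE[OF finI]) (simp add: case_prod_beta)
    also have "\<dots> \<le> (\<Prod>(c, a)\<in>I. real m * (if a \<in> A then 9 / 10 else 1))"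
      using cB by (intro prod_mono) auto
    also have "\<dots> = (\<Prod>c<200::nat. \<Prod>a<m. real m * (if a \<in> A then 9 / 10 else 1))"
      unfolding I_def by (rule prod.cartesian_product[symmetric])
    also have "\<dots> = ((\<Prod>a<m. real m * (if a \<in> A then 9 / 10 else 1))) ^ 200" by simp
    also have "(\<Prod>a<m. real m * (if a \<in> A then 9 / 10 else 1)) =
        real m ^ m * (\<Prod>a<m. if a \<in> A then 9 / 10 else 1)"
      by (subst prod.distrib) simp
    also have "(\<Prod>a<m. if a \<in> A then 9 / 10 else 1) = (9 / 10 :: real) ^ card A"
      using AB by (subst prod.inter_restrict[symmetric]) (auto simp: Int_absorb1)
    also have "(real m ^ m * (9 / 10) ^ card A) ^ 200 = real m ^ (200 * m) * (9 / 10) ^ (200 * card A)"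
      by (simp add: power_mult_distrib power_mult[symmetric] mult.commute)
    \<comment> \<open>\<open>card A \<ge> m / 10\<close> makes the exponent at least
      \<open>20 * m\<close>. The number 200 is chosen because \<open>(9 / 10) ^ 20 < 1 / 8\<close>,
      and \<open>(1 / 8) ^ m\<close> beats the \<open>4 ^ m\<close> pairs.\<close>
    also have "\<dots> \<le> real m ^ (200 * m) * (9 / 10) ^ (20 * m)"
      using AB by (intro mult_left_mono power_decreasing) auto
    also have "(9 / 10 :: real) ^ (20 * m) = ((9 / 10) ^ 20) ^ m" by (simp add: power_mult)
    also have "real m ^ (200 * m) * \<dots> \<le> real m ^ (200 * m) * (1 / 8) ^ m"
      by (intro mult_left_mono power_mono) (auto simp: eval_nat_numeral field_simps)
    finally show ?thesis .
  qed
  have finS: "finite S"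
    by (rule finite_subset[of _ "Pow {..<m} \<times> Pow {..<m}"]) (auto simp: S_def)
  have "card S \<le> card (Pow {..<m} \<times> Pow {..<m})"
    by (intro card_mono) (auto simp: S_def)
  also have "\<dots> = 4 ^ m"
    by (simp add: card_cartesian_product card_Pow flip: power_mult_distrib)
  finally have "real (card S) \<le> real (4 ^ m)" by (simp only: of_nat_le_iff)
  then have cardS: "real (card S) \<le> 4 ^ m" by simp
  have "real (card (\<Union>(A, B)\<in>S. bad A B)) \<le> (\<Sum>(A, B)\<in>S. real (card (bad A B)))"
    using card_UN_le[OF finS, of "\<lambda>(A, B). bad A B"]
    by (simp add: case_prod_beta flip: of_nat_sum)
  also have "\<dots> \<le> (\<Sum>_\<in>S. real m ^ (200 * m) * (1 / 8) ^ m)"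
    using card_bad by (intro sum_mono) auto
  also have "\<dots> \<le> 4 ^ m * (real m ^ (200 * m) * (1 / 8) ^ m)"
    using cardS by (simp add: mult_right_mono)
  also have "\<dots> = real m ^ (200 * m) * (1 / 2) ^ m"
    by (simp add: power_mult_distrib[symmetric])
  also have "\<dots> < real m ^ (200 * m)"
    using assms by (auto intro!: power_less_one_iff[THEN iffD2] simp: power_less_one_iff)
  finally have "card (\<Union>(A, B)\<in>S. bad A B) < card \<Omega>" using card\<Omega> by simp
  moreover have "finite (\<Union>(A, B)\<in>S. bad A B)"
    using finS finI by (auto simp: bad_def intro!: finite_PiE)
  ultimately have "\<not> \<Omega> \<subseteq> (\<Union>(A, B)\<in>S. bad A B)" using card_mono by (meson not_less)
  then obtain g where g: "g \<in> \<Omega>" "\<And>A B. (A, B) \<in> S \<Longrightarrow> g \<notin> bad A B" by auto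
  show thesis
  proof (rule that[of "curry g"])
    show "curry g c i < m" if "c < 200" "i < m" for c i
      using g(1) that by (auto simp: \<Omega>_def I_def)
  next
    fix A B assume AB: "A \<subseteq> {..<m}" "B \<subseteq> {..<m}" "m \<le> 10 * card A" "m \<le> 10 * card B"
    then have "g \<notin> bad A B" using g(2) by (simp add: S_def)
    with g(1) obtain c a where "(c, a) \<in> I" "a \<in> A" "g (c, a) \<in> B"
      unfolding bad_def \<Omega>_def by (auto simp: PiE_iff split: if_splits)
    then show "\<exists>c<200. \<exists>a\<in>A. curry g c a \<in> B" by (auto simp: I_def)
  qed
qed

text \<open>If one label has at least \<open>m / 10\<close> elements, it forms \<open>L\<close>: it
  has at most \<open>2 * m / 3\<close> of them, and \<open>9 / 10 - 2 / 3\<close> exceeds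
  \<open>1 / 10\<close>. Otherwise labels are added one by one until the union first reaches
  \<open>m / 10\<close>; it is then at most \<open>2 * m / 10\<close>, which leaves at least
  \<open>7 * m / 10\<close> outside.\<close>

lemma split_by_labels:
  fixes h :: "'a \<Rightarrow> 'b"
  assumes "finite U" "9 * m \<le> 10 * card U" and fibre: "\<And>a. 3 * card {u \<in> U. h u = a} \<le> 2 * m"
  obtains L where "m \<le> 10 * card {u \<in> U. h u \<in> L}" "m \<le> 10 * card {u \<in> U. h u \<notin> L}"
proof -
  have compl: "card {u \<in> U. h u \<in> L} + card {u \<in> U. h u \<notin> L} = card U" for L
    using assms(1) by (rule card_filter_split)
  show thesis
  proof (cases "\<exists>a. m \<le> 10 * card {u \<in> U. h u = a}")
    case True
    then obtain a where "m \<le> 10 * card {u \<in> U. h u = a}" by blast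
    moreover from this have "m \<le> 10 * card {u \<in> U. h u \<noteq> a}"
      using compl[of "{a}"] fibre[of a] assms(2) by simp
    ultimately show thesis by (intro that[of "{a}"]) auto
  next
    case False
    have small_union: "\<exists>L. finite L \<and> m \<le> 10 * card {u \<in> U. h u \<in> L} \<and> 10 * card {u \<in> U. h u \<in> L} \<le> 2 * m"
      if "finite M" "m \<le> 10 * card {u \<in> U. h u \<in> M}" for M
      using that
    proof (induction M)
      case empty
      then show ?case by (auto intro!: exI[of _ "{}"])
    next
      case (insert a M)
      show ?case
      proof (cases "m \<le> 10 * card {u \<in> U. h u \<in> M}")
        case True then show ?thesis using insert.IH by blast
      next
        case small: False
        have "card {u \<in> U. h u \<in> insert a M} \<le> card ({u \<in> U. h u = a} \<union> {u \<in> U. h u \<in> M})"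
          using assms(1) by (intro card_mono) auto
        also have "\<dots> \<le> card {u \<in> U. h u = a} + card {u \<in> U. h u \<in> M}" by (rule card_Un_le)
        finally have "10 * card {u \<in> U. h u \<in> insert a M} \<le> 2 * m"
          using small spec[OF False[unfolded not_ex], of a] by linarith
        then show ?thesis using insert by (intro exI[of _ "insert a M"]) auto
      qed
    qed
    have "{u \<in> U. h u \<in> h ` U} = U" "m \<le> 10 * card U" using assms(2) by auto
    then obtain L where "m \<le> 10 * card {u \<in> U. h u \<in> L}" "10 * card {u \<in> U. h u \<in> L} \<le> 2 * m"
      using small_union[OF finite_imageI[OF assms(1)], of h] by auto
    moreover from this have "m \<le> 10 * card {u \<in> U. h u \<notin> L}" using compl[of L] assms(2) by linarith
    ultimately show thesis by (intro that)
  qed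
qed

section \<open>Separators of subdivided expanders\<close>

lemma link_sym: "link l x y \<longleftrightarrow> link l y x"
  by (cases x; cases y) auto

text \<open>Walks are easiest to describe on values of type \<open>vertex\<close>; the inverse map
  \<open>p\<close> carries them into the abstract graph.\<close>

lemma embedding_inverse:
  assumes "embedding m l \<pi> G" and "\<pi> ` verts G = V"
  obtains p where "\<And>x. x \<in> V \<Longrightarrow> p x \<in> verts G" "\<And>x. x \<in> V \<Longrightarrow> \<pi> (p x) = x"
    "\<And>v. v \<in> verts G \<Longrightarrow> p (\<pi> v) = v" "inj_on p V"
    "\<And>x y. x \<in> V \<Longrightarrow> y \<in> V \<Longrightarrow> {p x, p y} \<in> edges G \<longleftrightarrow> link l x y"
proof (rule that[of "inv_into (verts G) \<pi>"])
  have inj: "inj_on \<pi> (verts G)" using assms(1) by (simp add: embedding_def)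
  show *: "inv_into (verts G) \<pi> x \<in> verts G" "\<pi> (inv_into (verts G) \<pi> x) = x" if "x \<in> V" for x
    using that assms(2) by (auto intro: inv_into_into f_inv_into_f)
  show "inv_into (verts G) \<pi> (\<pi> v) = v" if "v \<in> verts G" for v
    using inj that by (rule inv_into_f_f)
  show "inj_on (inv_into (verts G) \<pi>) V" using assms(2) by (simp add: inj_on_inv_into)
  show "{inv_into (verts G) \<pi> x, inv_into (verts G) \<pi> y} \<in> edges G \<longleftrightarrow> link l x y"
    if "x \<in> V" "y \<in> V" for x y
    using assms(1) *[OF that(1)] *[OF that(2)] by (simp add: embedding_def)
qed

text \<open>
  A branch vertex together with its \<open>200\<close> outgoing paths forms a block; all blocks have the same
  size, and a separator of fewer than \<open>m / 10\<close> vertices leaves more than \<open>9 m / 10\<close> blocks intact.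
\<close>

lemma subdivided_expander:
  assumes "m \<ge> 1" "l \<ge> 1"
  obtains V where "finite V" "V \<subseteq> host_verts m l" "card V = m * (1 + 200 * l)"
    "\<And>(G :: 'a graph) \<pi>. embedding m l \<pi> G \<Longrightarrow> \<pi> ` verts G = V \<Longrightarrow> m \<le> 10 * sep_number G"
proof -
  obtain f :: "nat \<Rightarrow> nat \<Rightarrow> nat" where f: "\<And>c i. c < 200 \<Longrightarrow> i < m \<Longrightarrow> f c i < m"
    and expand: "\<And>A B. \<lbrakk>A \<subseteq> {..<m}; B \<subseteq> {..<m}; m \<le> 10 * card A; m \<le> 10 * card B\<rbrakk> \<Longrightarrow>
      \<exists>c<200. \<exists>a\<in>A. f c a \<in> B"
    using expanding_functions[OF assms(1)] by metis
  \<comment> \<open>The index \<open>c\<close> keeps the 200 paths out of \<open>i\<close> distinct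
    even if some values \<open>f c i\<close> coincide, so every block has exactly
    \<open>1 + 200 * l\<close> vertices.\<close>
  define block where "block K = Branch ` K \<union>
    (\<lambda>(i, c, t). Inner (i, f c i, c) t) ` (K \<times> {..<200} \<times> {..<l})" for K
  define V where "V = block {..<m}"
  have card_block: "card (block K) = card K * (1 + 200 * l)" if "finite K" for K
  proof -
    have "card (block K) = card (Branch ` K) +
        card ((\<lambda>(i, c, t). Inner (i, f c i, c) t) ` (K \<times> {..<200} \<times> {..<l}))"
      unfolding block_def using that by (intro card_Un_disjoint) auto
    also have "card (Branch ` K) = card K" by (intro card_image) (auto simp: inj_on_def)
    also have "card ((\<lambda>(i, c, t). Inner (i, f c i, c) t) ` (K \<times> {..<200} \<times> {..<l})) =
        card (K \<times> {..<200::nat} \<times> {..<l})"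
      by (intro card_image) (auto simp: inj_on_def)
    finally show ?thesis by (simp add: card_cartesian_product)
  qed
  have mem: "Branch i \<in> V" "c < 200 \<Longrightarrow> t < l \<Longrightarrow> Inner (i, f c i, c) t \<in> V" if "i < m" for i c t
    using that by (force simp: V_def block_def)+
  define owner where "owner x = (case x of Branch i \<Rightarrow> i | Inner e t \<Rightarrow> src e)" for x
  have owner: "owner x < m" if "x \<in> V" for x
    using that by (auto simp: V_def block_def owner_def)
  show thesis
  proof (rule that[of V])
    show "finite V" by (auto simp: V_def block_def)
    show "V \<subseteq> host_verts m l" using f by (auto simp: V_def block_def host_verts_def)
    show cardV: "card V = m * (1 + 200 * l)" unfolding V_def by (subst card_block) auto
    fix G :: "'a graph" and \<pi> assume emb: "embedding m l \<pi> G" and V: "\<pi> ` verts G = V"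
    have sg: "simple_graph G" and inj: "inj_on \<pi> (verts G)" using emb by (auto simp: embedding_def)
    have finG: "finite (verts G)" using sg by (simp add: simple_graph_def)
    obtain p where p: "\<And>x. x \<in> V \<Longrightarrow> p x \<in> verts G" "\<And>x. x \<in> V \<Longrightarrow> \<pi> (p x) = x" "inj_on p V"
        "\<And>x y. x \<in> V \<Longrightarrow> y \<in> V \<Longrightarrow> {p x, p y} \<in> edges G \<longleftrightarrow> link l x y"
      using embedding_inverse[OF emb V] by metis
    have cardG: "card (verts G) = m * (1 + 200 * l)"
      using card_image[OF inj] V cardV by simp
    have "sep_number G \<in> card ` {X. balanced_separator G X}"
      unfolding sep_number_def using finite_balanced_separators[OF sg] balanced_separator_verts
      by (intro Min_in) auto
    then obtain X where X: "balanced_separator G X" "sep_number G = card X" by auto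
    show "m \<le> 10 * sep_number G"
    proof (rule ccontr)
      assume "\<not> m \<le> 10 * sep_number G"
      then have small: "10 * card X < m" using X by simp
      have XG: "X \<subseteq> verts G" using X by (simp add: balanced_separator_def)
      \<comment> \<open>Each vertex of \<open>X\<close> spoils only the block of its owner;
        \<open>U\<close> indexes the intact blocks.\<close>
      define T where "T = owner ` \<pi> ` X"
      define U where "U = {..<m} - T"
      have T: "T \<subseteq> {..<m}" using owner XG V by (auto simp: T_def)
      have "card T \<le> card X"
        unfolding T_def image_image using XG finG finite_subset by (intro card_image_le) auto
      moreover have "card U = m - card T"
        unfolding U_def using T finite_subset by (subst card_Diff_subset) auto
      ultimately have U: "9 * m \<le> 10 * card U" using small by linarith
      define G' where "G' = induced G (verts G - X)"
      define R where "R = adj G'"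
      have outside: "p x \<notin> X" if "x \<in> V" "owner x \<in> U" for x
      proof
        assume "p x \<in> X"
        then have "owner (\<pi> (p x)) \<in> T" unfolding T_def by blast
        with that p(2) show False by (simp add: U_def)
      qed
      have R: "(p x, p y) \<in> R" if "x \<in> V" "y \<in> V" "owner x \<in> U" "owner y \<in> U" "link l x y" for x y
      proof -
        have "p x \<notin> X" "p y \<notin> X" using outside that by auto
        then show ?thesis using p(1)[OF that(1)] p(1)[OF that(2)] p(4)[OF that(1,2)] that(5) by (auto simp: R_def G'_def adj_def induced_def)
      qed
      have "sym R" by (auto simp: R_def adj_def sym_def insert_commute)
      then have symR: "sym (R\<^sup>*)" by (rule sym_rtrancl)
      have inner: "(p (Branch i), p (Inner (i, f c i, c) t)) \<in> R\<^sup>*" if "i \<in> U" "c < 200" "t < l" for i c t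
        using that(3)
      proof (induction t)
        case 0
        have "(p (Branch i), p (Inner (i, f c i, c) 0)) \<in> R"
          using that 0 by (intro R) (auto simp: mem U_def owner_def)
        then show ?case by blast
      next
        case (Suc t)
        have "(p (Inner (i, f c i, c) t), p (Inner (i, f c i, c) (Suc t))) \<in> R"
          using that Suc.prems by (intro R) (auto simp: mem U_def owner_def)
        with Suc show ?case by (meson Suc_lessD rtrancl.rtrancl_into_rtrancl)
      qed
      \<comment> \<open>The component of its branch vertex labels each intact block. The label is
        constant along arcs between intact blocks, whereas expansion will produce such an arc
        between different labels.\<close>
      define h where "h i = {v \<in> verts G'. (p (Branch i), v) \<in> R\<^sup>*}" for i
      have step: "h i = h (f c i)" if "i \<in> U" "c < 200" "f c i \<in> U" for i c
      proof -
        have "(p (Inner (i, f c i, c) (l - 1)), p (Branch (f c i))) \<in> R"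
          using that assms(2) f by (intro R) (auto simp: mem U_def owner_def)
        with inner[of i c "l - 1"] that assms(2) have "(p (Branch i), p (Branch (f c i))) \<in> R\<^sup>*"
          by (meson diff_less less_le_trans rtrancl.rtrancl_into_rtrancl zero_less_one)
        then show ?thesis
          unfolding h_def using symR by (auto dest: symD intro: rtrancl_trans)
      qed
      \<comment> \<open>Blocks with the same label lie in one component, which has at most two
        thirds of all vertices. As all blocks have equal size, they are at most two thirds of all
        blocks.\<close>
      have fibre: "3 * card {i \<in> U. h i = a} \<le> 2 * m" for a
      proof (cases "{i \<in> U. h i = a} = {}")
        case False
        define K where "K = {i \<in> U. h i = a}"
        have KU: "K \<subseteq> U" "finite K" by (auto simp: K_def U_def)
        have "K \<subseteq> {..<m}" using KU by (auto simp: U_def)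
        then have KV: "block K \<subseteq> V" unfolding V_def block_def
          by (intro Un_mono image_mono Sigma_mono) auto
        have G': "p x \<in> verts G'" if "x \<in> block K" for x
        proof -
          have "x \<in> V" using that KV by blast
          moreover have "owner x \<in> U" using that KU by (auto simp: block_def owner_def)
          ultimately show ?thesis using p(1) outside by (simp add: G'_def induced_def)
        qed
        have sub: "p ` block K \<subseteq> a"
        proof
          fix v assume "v \<in> p ` block K"
          then obtain x where x: "x \<in> block K" "v = p x" by blast
          then obtain i where i: "i \<in> K" "(p (Branch i), p x) \<in> R\<^sup>*"
            using inner KU by (auto simp: block_def)
          with x G' show "v \<in> a" by (auto simp: K_def h_def)
        qed
        obtain i where i: "i \<in> U" "h i = a" using False by blast
        then have "p (Branch i) \<in> verts G'" using G'[of "Branch i"] by (auto simp: K_def block_def)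
        with i(2) have "a \<in> components G'" unfolding components_def h_def R_def by blast
        then have "real (card a) \<le> 2 * real (card (verts G)) / 3" and "a \<subseteq> verts G'"
          using X(1) by (auto simp: balanced_separator_def G'_def components_def)
        moreover have "finite (verts G')" using finG by (simp add: G'_def induced_def)
        ultimately have "3 * card a \<le> 2 * card (verts G)" "finite a"
          using finite_subset by (linarith, blast)
        moreover have "card K * (1 + 200 * l) = card (p ` block K)"
          using card_block[OF KU(2)] card_image[OF inj_on_subset[OF p(3) KV]] by simp
        ultimately have "3 * (card K * (1 + 200 * l)) \<le> 2 * (m * (1 + 200 * l))"
          using card_mono[OF \<open>finite a\<close> sub] cardG by linarith
        then have "(3 * card K) * (1 + 200 * l) \<le> (2 * m) * (1 + 200 * l)" by (simp only: mult.assoc)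
        then have "3 * card K \<le> 2 * m" by (simp only: mult_le_cancel2)
        then show ?thesis by (simp add: K_def)
      next
        case True
        then show ?thesis by (simp only: card.empty)
      qed
      have finU: "finite U" by (simp add: U_def)
      obtain L where L: "m \<le> 10 * card {i \<in> U. h i \<in> L}" "m \<le> 10 * card {i \<in> U. h i \<notin> L}"
        using split_by_labels[OF finU U fibre] by blast
      have "\<exists>c<200. \<exists>a\<in>{i \<in> U. h i \<in> L}. f c a \<in> {i \<in> U. h i \<notin> L}"
        using L by (intro expand) (auto simp: U_def)
      then obtain c i where "c < 200" "i \<in> U" "h i \<in> L" "f c i \<in> U" "h (f c i) \<notin> L" by auto
      then show False using step[of i c] by simp
    qed
  qed
qed

section \<open>Shallow clique minors\<close>

text \<open>Cutting every path in the middle yields bags consisting of a branch vertex and the half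
  paths at it. They have radius at most \<open>r\<close>, and the middle edge of the path from
  \<open>i\<close> to \<open>j\<close> joins their bags, so the contraction is a complete graph on
  \<open>m\<close> vertices.\<close>

lemma nabla_subdivided_complete:
  fixes G :: "'a graph"
  assumes "m \<ge> 1" "r \<ge> 1" and emb: "embedding m (2 * r) \<pi> G"
    and V: "\<pi> ` verts G = {Branch i | i. i < m} \<union> {Inner (i, j, 0) t | i j t. i < m \<and> j < m \<and> t < 2 * r}"
  shows "(real m - 1) / 2 \<le> nabla r G"
proof -
  define V where "V = {Branch i | i. i < m} \<union> {Inner (i, j, 0) t | i j t. i < m \<and> j < m \<and> t < 2 * r}"
  have \<pi>V: "\<pi> ` verts G = V" using V by (simp only: V_def)
  have mem: "Branch i \<in> V \<longleftrightarrow> i < m" "Inner (i, j, k) t \<in> V \<longleftrightarrow> i < m \<and> j < m \<and> k = 0 \<and> t < 2 * r"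
    for i j k t by (auto simp: V_def)
  have sg: "simple_graph G" using emb by (simp add: embedding_def)
  obtain p where p: "\<And>x. x \<in> V \<Longrightarrow> p x \<in> verts G" "\<And>x. x \<in> V \<Longrightarrow> \<pi> (p x) = x"
      "\<And>v. v \<in> verts G \<Longrightarrow> p (\<pi> v) = v"
      "\<And>x y. x \<in> V \<Longrightarrow> y \<in> V \<Longrightarrow> {p x, p y} \<in> edges G \<longleftrightarrow> link (2 * r) x y"
    using embedding_inverse[OF emb \<pi>V] by metis
  define \<psi> where "\<psi> x = (case x of Branch i \<Rightarrow> i | Inner e t \<Rightarrow> if t < r then src e else tgt e)" for x
  define W where "W i = {v \<in> verts G. \<psi> (\<pi> v) = i}" for i
  define F where "F i = induced G (W i)" for i
  have \<psi>: "\<psi> (\<pi> v) < m" if "v \<in> verts G" for v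
  proof -
    have "\<pi> v \<in> V" using that \<pi>V by blast
    then show ?thesis by (auto simp: \<psi>_def V_def)
  qed
  have branch: "p (Branch i) \<in> W i" if "i < m" for i
    using that p(1,2)[of "Branch i"] by (auto simp: W_def mem \<psi>_def)
  have vF: "verts (F i) = W i" for i by (simp add: F_def induced_def)
  have subF: "subgraph (F i) G" for i
    using sg by (auto simp: F_def induced_def subgraph_def simple_graph_def W_def)
  have subG: "subgraph G G" using sg by (simp add: subgraph_def)
  have adjF: "(p x, p y) \<in> adj (F i)"
    if "x \<in> V" "y \<in> V" "\<psi> x = i" "\<psi> y = i" "link (2 * r) x y" for x y i
    using that p(1)[OF that(1)] p(1)[OF that(2)] p(2)[OF that(1)] p(2)[OF that(2)] p(4)[OF that(1,2)]
    by (simp add: adj_def F_def induced_def W_def)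
  have outward: "(p (Branch i), p (Inner (i, j, 0) t)) \<in> adj (F i) ^^ Suc t"
    if "i < m" "j < m" "t < r" for i j t
    using that(3)
  proof (induction t)
    case 0
    have "(p (Branch i), p (Inner (i, j, 0) 0)) \<in> adj (F i)"
      using that by (intro adjF) (auto simp: \<psi>_def mem)
    then show ?case by simp
  next
    case (Suc t)
    have "(p (Inner (i, j, 0) t), p (Inner (i, j, 0) (Suc t))) \<in> adj (F i)"
      using that Suc.prems by (intro adjF) (auto simp: \<psi>_def mem)
    with Suc show ?case by (meson Suc_lessD relpow_Suc_I)
  qed
  \<comment> \<open>Positions are counted back from the target; \<open>s < r\<close> keeps the walk
    in the half that belongs to \<open>j\<close>.\<close>
  have inward: "(p (Branch j), p (Inner (i, j, 0) (2 * r - Suc s))) \<in> adj (F j) ^^ Suc s"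
    if "i < m" "j < m" "s < r" for i j s
    using that(3)
  proof (induction s)
    case 0
    have "(p (Branch j), p (Inner (i, j, 0) (2 * r - Suc 0))) \<in> adj (F j)"
      using that by (intro adjF) (auto simp: \<psi>_def mem)
    then show ?case by simp
  next
    case (Suc s)
    have "(p (Inner (i, j, 0) (2 * r - Suc s)), p (Inner (i, j, 0) (2 * r - Suc (Suc s)))) \<in> adj (F j)"
      using that Suc.prems by (intro adjF) (auto simp: \<psi>_def mem)
    with Suc show ?case by (meson Suc_lessD relpow_Suc_I)
  qed
  have near: "\<exists>k\<le>r. (p (Branch i), v) \<in> adj (F i) ^^ k" if "v \<in> W i" for i v
  proof -
    have v: "\<pi> v \<in> V" "p (\<pi> v) = v" "\<psi> (\<pi> v) = i" using that \<pi>V p(3) by (auto simp: W_def)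
    from v(1) consider j where "\<pi> v = Branch j" | a b t where "\<pi> v = Inner (a, b, 0) t" "a < m" "b < m" "t < 2 * r"
      unfolding V_def by blast
    then show ?thesis
    proof cases
      case 1
      with v have "v = p (Branch i)" by (simp add: \<psi>_def)
      then show ?thesis by (intro exI[of _ 0]) simp
    next
      case 2
      show ?thesis
      proof (cases "t < r")
        case True
        with 2 v outward[of a b t] show ?thesis by (intro exI[of _ "Suc t"]) (simp add: \<psi>_def)
      next
        case False
        define s where "s = 2 * r - Suc t"
        have s: "s < r" "t = 2 * r - Suc s" using False 2 by (auto simp: s_def)
        have "i = b" using False 2 v by (simp add: \<psi>_def)
        then show ?thesis
          using inward[of a b s] 2 v s by (intro exI[of _ "Suc s"]) (simp del: relpow.simps)
      qed
    qed
  qed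
  have rad: "radius (F i) \<le> enat r" if "i < m" for i
  proof -
    have "gdist (F i) (p (Branch i)) v \<le> enat r" if v: "v \<in> verts (F i)" for v
    proof -
      obtain k where "k \<le> r" "(p (Branch i), v) \<in> adj (F i) ^^ k" using near v vF by blast
      then show ?thesis unfolding gdist_def by (intro INF_lower2[of k]) auto
    qed
    then show ?thesis
      unfolding radius_def using branch[OF that] vF by (intro INF_lower2[of "p (Branch i)"] SUP_least) auto
  qed
  define M where "M = contract G (F ` {..<m})"
  have disj: "disjoint_family_on verts (F ` {..<m})"
    by (auto simp: disjoint_family_on_def vF W_def)
  have minor: "M \<in> shallow_minors r G"
    unfolding shallow_minors_def M_def using subG subF rad disj by blast
  \<comment> \<open>The sets \<open>W i\<close> cover all vertices, so the contraction has no
    additional singleton bags.\<close>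
  have "verts G - \<Union> (verts ` F ` {..<m}) = {}" using \<psi> by (auto simp: vF W_def)
  then have bags: "bags G (F ` {..<m}) = W ` {..<m}" unfolding bags_def by (auto simp: vF image_image)
  have injW: "inj_on W {..<m}"
  proof (rule inj_onI)
    fix i j assume "i \<in> {..<m}" "W i = W j"
    then have "p (Branch i) \<in> W i \<inter> W j" using branch by auto
    then show "i = j" by (auto simp: W_def)
  qed
  have crossing: "\<exists>a\<in>W i. \<exists>b\<in>W j. {a, b} \<in> edges G" if "i < m" "j < m" for i j
  proof -
    let ?x = "Inner (i, j, 0) (r - 1)" and ?y = "Inner (i, j, 0) r"
    have xy: "?x \<in> V" "?y \<in> V" "link (2 * r) ?x ?y" using that assms(2) by (auto simp: mem)
    then have "{p ?x, p ?y} \<in> edges G" using p(4) by blast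
    moreover have "p ?x \<in> W i" "p ?y \<in> W j"
      using p(1)[OF xy(1)] p(1)[OF xy(2)] p(2)[OF xy(1)] p(2)[OF xy(2)] assms(2)
      by (auto simp: W_def \<psi>_def)
    ultimately show ?thesis by blast
  qed
  have "edges M = {e. e \<subseteq> W ` {..<m} \<and> card e = 2}"
  proof
    show "edges M \<subseteq> {e. e \<subseteq> W ` {..<m} \<and> card e = 2}"
    proof
      fix e assume "e \<in> edges M"
      then obtain A B where "e = {A, B}" "A \<noteq> B" "A \<in> W ` {..<m}" "B \<in> W ` {..<m}"
        unfolding M_def contract_def bags by auto
      then show "e \<in> {e. e \<subseteq> W ` {..<m} \<and> card e = 2}" by (simp add: card_2_iff) blast
    qed
    show "{e. e \<subseteq> W ` {..<m} \<and> card e = 2} \<subseteq> edges M"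
    proof
      fix e assume "e \<in> {e. e \<subseteq> W ` {..<m} \<and> card e = 2}"
      then have "e \<subseteq> W ` {..<m}" "card e = 2" by simp_all
      from \<open>card e = 2\<close> obtain A B where AB: "e = {A, B}" "A \<noteq> B"
        unfolding card_2_iff by (elim exE conjE)
      with \<open>e \<subseteq> _\<close> have e: "A \<in> W ` {..<m}" "B \<in> W ` {..<m}" by simp_all
      then obtain i j where ij: "i < m" "j < m" "A = W i" "B = W j" by auto
      have "\<exists>a\<in>A. \<exists>b\<in>B. {a, b} \<in> edges G" unfolding ij using ij(1,2) by (rule crossing)
      then have "A \<in> W ` {..<m} \<and> B \<in> W ` {..<m} \<and> A \<noteq> B \<and> (\<exists>a\<in>A. \<exists>b\<in>B. {a, b} \<in> edges G)"
        using e AB(2) by (intro conjI)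
      then show "e \<in> edges M" unfolding M_def contract_def bags graph.sel mem_Collect_eq AB(1)
        by (intro exI[of _ A] exI[of _ B] conjI refl) auto
    qed
  qed
  then have "card (edges M) = m choose 2"
    using n_subsets[of "W ` {..<m}" 2] card_image[OF injW] by simp
  moreover have "card (verts M) = m"
    using card_image[OF injW] by (simp add: M_def contract_def bags)
  moreover have "real (m choose 2) = real m * (real m - 1) / 2"
    using assms(1) by (simp add: choose_two real_of_nat_div)
  ultimately have "density M = (real m - 1) / 2"
    using assms(1) by (simp add: density_def)
  moreover have "density M \<le> nabla r G"
    unfolding nabla_def using finite_shallow_minors[OF sg] minor by (intro Max_ge) auto
  ultimately show ?thesis by simp
qed

section \<open>The graph class\<close>

text \<open>Members of a class have natural numbers as vertices, so the vertex set is encoded by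
  \<open>to_nat\<close>; then \<open>from_nat\<close> is an embedding.\<close>

definition host_graph :: "nat \<Rightarrow> vertex set \<Rightarrow> nat graph" where
  "host_graph l V = Graph (to_nat ` V) {{to_nat x, to_nat y} | x y. x \<in> V \<and> y \<in> V \<and> link l x y}"

lemma embedding_host_graph:
  assumes "finite V" "V \<subseteq> host_verts m l"
  shows "embedding m l from_nat (host_graph l V)"
    and "from_nat ` verts (host_graph l V) = V"
    and "card (verts (host_graph l V)) = card V"
proof -
  have irrefl: "\<not> link l x x" for x by (cases x) auto
  have edge: "{to_nat x, to_nat y} \<in> edges (host_graph l V) \<longleftrightarrow> link l x y" if "x \<in> V" "y \<in> V" for x y
    using that link_sym by (auto simp: host_graph_def doubleton_eq_iff)
  have "simple_graph (host_graph l V)"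
    using assms(1) irrefl by (fastforce simp: simple_graph_def host_graph_def card_2_iff)
  then show "embedding m l from_nat (host_graph l V)"
    using assms(2) edge by (auto simp: embedding_def host_graph_def inj_on_def image_image)
  show "from_nat ` verts (host_graph l V) = V" by (simp add: host_graph_def image_image)
  show "card (verts (host_graph l V)) = card V"
    by (simp add: host_graph_def card_image)
qed

section \<open>Two upper bounds on the separator number\<close>

lemma sep_number_le_branches:
  assumes emb: "embedding m l \<pi> G"
  shows "sep_number G \<le> m + 2"
proof -
  have inj: "inj_on \<pi> (verts G)" and host: "\<pi> ` verts G \<subseteq> host_verts m l"
    using emb by (auto simp: embedding_def)
  define X where "X = {v \<in> verts G. \<exists>i. \<pi> v = Branch i}"
  have "inj_on \<pi> X" using inj by (rule inj_on_subset) (auto simp: X_def)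
  moreover have "\<pi> ` X \<subseteq> Branch ` {..<m}" using host by (fastforce simp: X_def host_verts_def)
  ultimately have "card X \<le> card (Branch ` {..<m})" by (intro card_inj_on_le) auto
  also have "\<dots> \<le> m" using card_image_le[of "{..<m}" Branch] by simp
  finally have "card X \<le> m" .
  moreover have "sep_number G \<le> card X + 2"
  proof (rule sep_number_subdivision_le[OF emb])
    show "X \<subseteq> verts G" by (auto simp: X_def)
    \<comment> \<open>No branch vertex survives, so the cut condition holds vacuously.\<close>
    have "Branch i \<notin> \<pi> ` (verts G - X)" for i
    proof
      assume "Branch i \<in> \<pi> ` (verts G - X)"
      then obtain v where "v \<in> verts G - X" "\<pi> v = Branch i" by (metis imageE)
      then show False by (simp add: X_def)
    qed
    then show "\<exists>t<l. Inner e t \<notin> \<pi> ` (verts G - X)" if "Branch (src e) \<in> \<pi> ` (verts G - X)" for e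
      using that by blast
  qed
  ultimately show ?thesis by simp
qed

text \<open>\<open>k\<close> counts the arcs with all inner vertices present. These occupy disjoint
  sets of \<open>l\<close> vertices, and deleting the first inner vertex of each leaves no complete
  path.\<close>

lemma sep_number_le_full_arcs:
  assumes emb: "embedding m l \<pi> G" and "l \<ge> 1"
  obtains k where "k * l \<le> card (verts G)" "sep_number G \<le> k + 2"
proof -
  have fin: "finite (verts G)" and inj: "inj_on \<pi> (verts G)"
    using emb by (auto simp: embedding_def simple_graph_def)
  define E where "E = {e. \<forall>t<l. Inner e t \<in> \<pi> ` verts G}"
  define X where "X = {v \<in> verts G. \<exists>e\<in>E. \<pi> v = Inner e 0}"
  have "(\<lambda>e. Inner e 0) ` E \<subseteq> \<pi> ` verts G" using assms(2) by (auto simp: E_def)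
  then have "finite ((\<lambda>e. Inner e 0) ` E)" using fin finite_subset by blast
  then have finE: "finite E" by (rule finite_imageD) (simp add: inj_on_def)
  have "inj_on (\<lambda>(e, t). Inner e t) (E \<times> {..<l})" by (auto simp: inj_on_def)
  moreover have "(\<lambda>(e, t). Inner e t) ` (E \<times> {..<l}) \<subseteq> \<pi> ` verts G" by (auto simp: E_def)
  ultimately have "card (E \<times> {..<l}) \<le> card (\<pi> ` verts G)" using fin by (intro card_inj_on_le) auto
  then have "card E * l \<le> card (verts G)" by (simp add: card_cartesian_product card_image[OF inj])
  moreover have "sep_number G \<le> card E + 2"
  proof -
    have "inj_on \<pi> X" using inj by (rule inj_on_subset) (auto simp: X_def)
    moreover have "\<pi> ` X \<subseteq> (\<lambda>e. Inner e 0) ` E" by (auto simp: X_def)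
    ultimately have "card X \<le> card ((\<lambda>e. Inner e 0) ` E)" using finE by (intro card_inj_on_le) auto
    also have "\<dots> \<le> card E" using finE by (rule card_image_le)
    finally have "card X \<le> card E" .
    moreover have "sep_number G \<le> card X + 2"
    proof (rule sep_number_subdivision_le[OF emb])
      show "X \<subseteq> verts G" by (auto simp: X_def)
      fix e
      show "\<exists>t<l. Inner e t \<notin> \<pi> ` (verts G - X)"
      proof (rule ccontr)
        assume "\<not> (\<exists>t<l. Inner e t \<notin> \<pi> ` (verts G - X))"
        then have all: "\<And>t. t < l \<Longrightarrow> Inner e t \<in> \<pi> ` (verts G - X)" by blast
        then have "e \<in> E" unfolding E_def by blast
        moreover obtain v where "v \<in> verts G - X" "\<pi> v = Inner e 0" using all[of 0] assms(2) by auto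
        ultimately show False by (auto simp: X_def)
      qed
    qed
    ultimately show ?thesis by simp
  qed
  ultimately show thesis by (rule that)
qed

text \<open>For the largest \<open>m\<close> and boundedly many paths per branch vertex, the order
  \<open>n\<close> is about \<open>m * l\<close>, hence about
  \<open>l powr (1 / \<epsilon>)\<close>, and \<open>m\<close> is about
  \<open>n powr (1 - \<epsilon>)\<close>. The factor 2 leaves room for rounding.\<close>

definition subdivision_class :: "real \<Rightarrow> nat graph set" where
  "subdivision_class \<epsilon> =
     {G. \<exists>m l \<pi>. l \<ge> 1 \<and> real m \<le> 2 * real l powr (1 / \<epsilon> - 1) \<and> embedding m l \<pi> G}"

section \<open>Closure under isomorphism and induced subgraphs\<close>

lemma graph_class_subdivision_class: "graph_class (subdivision_class \<epsilon>)"
  unfolding graph_class_def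
proof (intro conjI ballI allI impI)
  fix G assume G: "G \<in> subdivision_class \<epsilon>"
  then show "simple_graph G" by (auto simp: subdivision_class_def embedding_def)
  fix H :: "nat graph" assume "simple_graph H \<and> graph_iso G H"
  then obtain f where H: "simple_graph H" and f: "bij_betw f (verts G) (verts H)"
      "\<And>u v. u \<in> verts G \<Longrightarrow> v \<in> verts G \<Longrightarrow> {u, v} \<in> edges G \<longleftrightarrow> {f u, f v} \<in> edges H"
    by (auto simp: graph_iso_def)
  from G obtain m l \<pi> where ml: "l \<ge> 1" "real m \<le> 2 * real l powr (1 / \<epsilon> - 1)"
    and emb: "embedding m l \<pi> G" by (auto simp: subdivision_class_def)
  define g where "g = inv_into (verts G) f"
  have g: "bij_betw g (verts H) (verts G)" unfolding g_def using f(1) by (rule bij_betw_inv_into)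
  have gv: "g v \<in> verts G" "f (g v) = v" if "v \<in> verts H" for v
    using that f(1) g by (auto simp: g_def bij_betw_def intro: f_inv_into_f inv_into_into)
  have "{u, v} \<in> edges H \<longleftrightarrow> link l (\<pi> (g u)) (\<pi> (g v))" if "u \<in> verts H" "v \<in> verts H" for u v
    using f(2)[of "g u" "g v"] gv[OF that(1)] gv[OF that(2)] emb by (simp add: embedding_def)
  moreover have "inj_on (\<pi> \<circ> g) (verts H)"
    using g emb by (auto simp: bij_betw_def embedding_def intro: comp_inj_on)
  ultimately have "embedding m l (\<pi> \<circ> g) H"
    using H emb gv(1) by (auto simp: embedding_def)
  with ml show "H \<in> subdivision_class \<epsilon>" by (auto simp: subdivision_class_def)
qed

lemma hereditary_subdivision_class: "hereditary (subdivision_class \<epsilon>)"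
  unfolding hereditary_def
proof (intro ballI allI impI)
  fix G X assume G: "G \<in> subdivision_class \<epsilon>" and X: "X \<subseteq> verts G"
  from G obtain m l \<pi> where ml: "l \<ge> 1" "real m \<le> 2 * real l powr (1 / \<epsilon> - 1)"
    and emb: "embedding m l \<pi> G" by (auto simp: subdivision_class_def)
  have "finite X" "inj_on \<pi> X"
    using emb X by (auto simp: embedding_def simple_graph_def intro: finite_subset inj_on_subset)
  moreover have "\<pi> ` X \<subseteq> host_verts m l"
    using emb X by (auto simp: embedding_def)
  moreover have "{u, v} \<in> edges G \<longleftrightarrow> link l (\<pi> u) (\<pi> v)" if "u \<in> X" "v \<in> X" for u v
    using emb X that by (simp add: embedding_def subset_iff)
  ultimately have "embedding m l \<pi> (induced G X)"
    using emb by (auto simp: embedding_def induced_def simple_graph_def)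
  with ml show "induced G X \<in> subdivision_class \<epsilon>" by (auto simp: subdivision_class_def)
qed

text \<open>Rounding \<open>2 * x\<close> down loses less than 1, hence less than
  \<open>x\<close>.\<close>

lemma nat_floor_double:
  fixes x :: real
  assumes "x \<ge> 1"
  shows "real (nat \<lfloor>2 * x\<rfloor>) \<le> 2 * x" "x \<le> real (nat \<lfloor>2 * x\<rfloor>)" "2 \<le> nat \<lfloor>2 * x\<rfloor>"
  using assms by linarith+

section \<open>Growth of separators and of shallow minor densities\<close>

context
  fixes \<epsilon> :: real
  assumes eps: "0 < \<epsilon>" "\<epsilon> \<le> 1"
begin

lemma exponent_product: "\<epsilon> * (1 / \<epsilon> - 1) = 1 - \<epsilon>"
  using eps by (simp add: right_diff_distrib)

text \<open>The threshold is \<open>l = n powr \<epsilon>\<close>: longer paths leave room for at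
  most \<open>n powr (1 - \<epsilon>)\<close> complete ones, shorter paths force
  \<open>m \<le> 2 * n powr (1 - \<epsilon>)\<close>. The additive 2 for balancing is absorbed since
  the power of \<open>n\<close> is at least 1.\<close>

lemma class_sep_le:
  assumes "n \<ge> 1"
  shows "real (class_sep (subdivision_class \<epsilon>) n) \<le> 4 * real n powr (1 - \<epsilon>)"
proof -
  have "real (sep_number G) \<le> 4 * real n powr (1 - \<epsilon>)"
    if "G \<in> subdivision_class \<epsilon>" "card (verts G) \<le> n" for G
  proof -
    from that obtain m l \<pi> where ml: "l \<ge> 1" "real m \<le> 2 * real l powr (1 / \<epsilon> - 1)"
      and emb: "embedding m l \<pi> G" by (auto simp: subdivision_class_def)
    have "1 \<le> real n powr (1 - \<epsilon>)" using assms eps by (simp add: ge_one_powr_ge_zero)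
    moreover have "real (sep_number G) \<le> 2 * real n powr (1 - \<epsilon>) + 2"
    proof (cases "real n powr \<epsilon> \<le> real l")
      case True
      obtain k where k: "k * l \<le> card (verts G)" "sep_number G \<le> k + 2"
        using sep_number_le_full_arcs[OF emb ml(1)] by blast
      have "real k * real n powr \<epsilon> \<le> real k * real l" using True by (intro mult_left_mono) auto
      also have "\<dots> \<le> real n" using k(1) that(2) by (metis le_trans of_nat_le_iff of_nat_mult)
      also have "\<dots> = real n powr (1 - \<epsilon>) * real n powr \<epsilon>"
        using assms by (simp flip: powr_add)
      finally have "real k \<le> real n powr (1 - \<epsilon>)" using assms by simp
      moreover have "real (sep_number G) \<le> real k + 2" using k(2) by linarith
      moreover have "0 \<le> real n powr (1 - \<epsilon>)" by simp
      ultimately show ?thesis by linarith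
    next
      case False
      have "real l powr (1 / \<epsilon> - 1) \<le> (real n powr \<epsilon>) powr (1 / \<epsilon> - 1)"
        using False eps by (intro powr_mono2) auto
      also have "\<dots> = real n powr (1 - \<epsilon>)"
        by (simp add: powr_powr exponent_product)
      finally show ?thesis using ml(2) sep_number_le_branches[OF emb] by linarith
    qed
    ultimately show ?thesis by linarith
  qed
  \<comment> \<open>The null graph makes the set of separator numbers nonempty, so that its
    \<open>Max\<close> is attained.\<close>
  moreover have "embedding 0 1 (\<lambda>_. Branch 0) (Graph {} {})"
    by (simp add: embedding_def simple_graph_def)
  then have "Graph {} {} \<in> subdivision_class \<epsilon>"
    unfolding subdivision_class_def by force
  then have "class_sep (subdivision_class \<epsilon>) n
      \<in> {sep_number G | G. G \<in> subdivision_class \<epsilon> \<and> card (verts G) \<le> n}"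
    unfolding class_sep_def
    using finite_class_sep[OF graph_class_subdivision_class] nonempty_class_sep[OF hereditary_subdivision_class]
    by (intro Max_in) auto
  ultimately show ?thesis by auto
qed

lemma class_sep_ge:
  assumes "n \<ge> 402"
  shows "((1 / 402) powr \<epsilon> / 2) powr (1 / \<epsilon> - 1) / 10 * real n powr (1 - \<epsilon>)
    \<le> real (class_sep (subdivision_class \<epsilon>) n)"
proof -
  define b where "b = 1 / \<epsilon> - 1"
  have b: "b \<ge> 0" using eps by (simp add: b_def)
  \<comment> \<open>Since \<open>402 = 2 * 201\<close>, the graph below has
    \<open>m * (1 + 200 * l) \<le> 402 * l powr (1 / \<epsilon>)\<close> vertices, which is at most
    \<open>n\<close> for \<open>l \<le> x\<close>.\<close>
  define x where "x = (real n / 402) powr \<epsilon>"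
  define l where "l = nat \<lfloor>x\<rfloor>"
  have x: "x \<ge> 1" unfolding x_def using assms eps by (intro ge_one_powr_ge_zero) auto
  then have "1 \<le> \<lfloor>x\<rfloor>" by simp
  then have l: "1 \<le> l" "real l \<le> x" "x / 2 \<le> real l" unfolding l_def by linarith+
  define m where "m = nat \<lfloor>2 * real l powr b\<rfloor>"
  have lb: "real l powr b \<ge> 1" using l b by (intro ge_one_powr_ge_zero) auto
  note m = nat_floor_double[OF lb, folded m_def]
  obtain V where V: "finite V" "V \<subseteq> host_verts m l" "card V = m * (1 + 200 * l)"
    "\<And>(G :: nat graph) \<pi>. embedding m l \<pi> G \<Longrightarrow> \<pi> ` verts G = V \<Longrightarrow> m \<le> 10 * sep_number G"
    using subdivided_expander[of m l] m(3) l(1) by auto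
  define G where "G = host_graph l V"
  note G = embedding_host_graph[OF V(1,2), folded G_def]
  have "G \<in> subdivision_class \<epsilon>" using G(1) l(1) m(1) by (auto simp: subdivision_class_def b_def)
  moreover have "card (verts G) \<le> n"
  proof -
    have "real (card (verts G)) = real m * (1 + 200 * real l)" using G(3) V(3) by (simp add: distrib_left)
    also have "\<dots> \<le> (2 * real l powr b) * (201 * real l)" using m(1) l(1) by (intro mult_mono) auto
    also have "\<dots> = 402 * real l powr (1 / \<epsilon>)" using l(1) by (simp add: b_def powr_diff)
    also have "\<dots> \<le> 402 * x powr (1 / \<epsilon>)" using l eps by (intro mult_left_mono powr_mono2) auto
    also have "\<dots> = real n" using eps assms by (simp add: x_def powr_powr)
    finally show ?thesis by simp
  qed
  ultimately have "sep_number G \<le> class_sep (subdivision_class \<epsilon>) n"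
    unfolding class_sep_def using finite_class_sep[OF graph_class_subdivision_class] by (intro Max_ge) auto
  moreover have "m \<le> 10 * sep_number G" using V(4)[OF G(1,2)] .
  \<comment> \<open>This combines \<open>m \<ge> l powr b\<close> with \<open>l \<ge> x / 2\<close>;
    the constant is what \<open>(x / 2) powr b\<close> leaves besides
    \<open>n powr (1 - \<epsilon>)\<close>.\<close>
  moreover have "((1 / 402) powr \<epsilon> / 2) powr b * real n powr (1 - \<epsilon>) \<le> real m"
  proof -
    have "((1 / 402) powr \<epsilon> / 2) powr b * real n powr (1 - \<epsilon>) =
        ((1 / 402) powr \<epsilon> / 2) powr b * (real n powr \<epsilon>) powr b"
      by (simp add: powr_powr b_def exponent_product)
    also have "\<dots> = (x / 2) powr b"
      by (simp add: x_def powr_divide powr_mult[symmetric] flip: powr_mult)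
    also have "\<dots> \<le> real l powr b" using l x b by (intro powr_mono2) auto
    finally show ?thesis using m(2) by linarith
  qed
  ultimately show ?thesis unfolding b_def by linarith
qed

lemma class_sep_bigtheta:
  "(\<lambda>n. real (class_sep (subdivision_class \<epsilon>) n)) \<in> \<Theta>(\<lambda>n. real n powr (1 - \<epsilon>))"
proof (rule bigthetaI)
  show "(\<lambda>n. real (class_sep (subdivision_class \<epsilon>) n)) \<in> O(\<lambda>n. real n powr (1 - \<epsilon>))"
    using class_sep_le by (intro bigoI[of _ 4] eventually_sequentiallyI[of 1]) auto
  show "(\<lambda>n. real (class_sep (subdivision_class \<epsilon>) n)) \<in> \<Omega>(\<lambda>n. real n powr (1 - \<epsilon>))"
    using class_sep_ge
    by (intro landau_omega.bigI[of "((1 / 402) powr \<epsilon> / 2) powr (1 / \<epsilon> - 1) / 10"]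
        eventually_sequentiallyI[of 402]) auto
qed

text \<open>Take \<open>l = 2 * r\<close> and one path for every ordered pair of branch vertices.
  The clique minor has density \<open>(m - 1) / 2\<close>, which is at least \<open>m / 4\<close>
  because \<open>m \<ge> 2\<close>, and \<open>m \<ge> r powr b\<close>.\<close>

lemma class_nabla_ge:
  assumes "r \<ge> 1"
  shows "ereal (real r powr (1 / \<epsilon> - 1) / 4) \<le> class_nabla (subdivision_class \<epsilon>) r"
proof -
  define b where "b = 1 / \<epsilon> - 1"
  have b: "b \<ge> 0" using eps by (simp add: b_def)
  define m where "m = nat \<lfloor>2 * real (2 * r) powr b\<rfloor>"
  have "real (2 * r) powr b \<ge> 1" using assms b by (intro ge_one_powr_ge_zero) auto
  note m = nat_floor_double[OF this, folded m_def]
  define V where "V = {Branch i | i. i < m} \<union> {Inner (i, j, 0) t | i j t. i < m \<and> j < m \<and> t < 2 * r}"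
  have "V \<subseteq> Branch ` {..<m} \<union> (\<lambda>(i, j, t). Inner (i, j, 0) t) ` ({..<m} \<times> {..<m} \<times> {..<2 * r})"
    by (force simp: V_def)
  then have "finite V" by (rule finite_subset) auto
  moreover have "V \<subseteq> host_verts m (2 * r)" by (auto simp: V_def host_verts_def)
  ultimately have emb: "embedding m (2 * r) from_nat (host_graph (2 * r) V)"
    "from_nat ` verts (host_graph (2 * r) V) = V"
    by (rule embedding_host_graph)+
  have "2 * r \<ge> 1" using assms by simp
  then have "host_graph (2 * r) V \<in> subdivision_class \<epsilon>"
    using emb(1) m(1) unfolding subdivision_class_def b_def by blast
  then have "ereal (nabla r (host_graph (2 * r) V)) \<le> class_nabla (subdivision_class \<epsilon>) r"
    unfolding class_nabla_def by (rule SUP_upper)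
  moreover have "real r powr b / 4 \<le> nabla r (host_graph (2 * r) V)"
  proof -
    have "real r powr b \<le> real (2 * r) powr b" using b by (intro powr_mono2) auto
    then have "real r powr b \<le> real m" using m(2) by (rule order_trans)
    moreover have "2 \<le> real m" using m(3) by simp
    ultimately have "real r powr b / 4 \<le> (real m - 1) / 2" by (simp add: field_simps)
    also have "(real m - 1) / 2 \<le> nabla r (host_graph (2 * r) V)"
      using nabla_subdivided_complete[OF _ assms emb(1)] emb(2) m(3) by (simp add: V_def)
    finally show ?thesis .
  qed
  ultimately show ?thesis unfolding b_def by (meson ereal_less_eq(3) order_trans)
qed

end

section \<open>Comparison of exponents\<close>

theorem lemma11:
  fixes \<epsilon> :: real
  assumes "0 < \<epsilon>" and "\<epsilon> \<le> 1"
  shows "B_exp \<epsilon> \<ge> ereal (1 / \<epsilon> - 1)"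
  unfolding B_exp_def
proof (intro Inf_greatest, elim imageE CollectE, simp only: ereal_less_eq)
  fix B :: real
  assume "\<forall>\<G>. graph_class \<G> \<and> hereditary \<G> \<and>
       (\<lambda>n. real (class_sep \<G> n)) \<in> \<Theta>(\<lambda>n. real n powr (1 - \<epsilon>)) \<longrightarrow> nabla_bigo \<G> B"
  then have "nabla_bigo (subdivision_class \<epsilon>) B"
    using graph_class_subdivision_class hereditary_subdivision_class class_sep_bigtheta[OF assms] by blast
  then obtain c where c: "\<forall>\<^sub>F r in sequentially.
      class_nabla (subdivision_class \<epsilon>) r \<le> ereal (c * real r powr B)"
    by (auto simp: nabla_bigo_def)
  show "1 / \<epsilon> - 1 \<le> B"
  proof (rule ccontr)
    \<comment> \<open>With a positive gap \<open>d\<close>, the two bounds on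
      \<open>class_nabla\<close> would keep \<open>r powr d\<close> below \<open>4 * c\<close>,
      although it tends to infinity.\<close>
    define d where "d = 1 / \<epsilon> - 1 - B"
    assume "\<not> 1 / \<epsilon> - 1 \<le> B"
    then have "d > 0" by (simp add: d_def)
    \<comment> \<open>The maximum with 1 makes \<open>K\<close> positive whatever the sign of
      \<open>c\<close>, so that the powers \<open>1 / d\<close> and \<open>d\<close> cancel.\<close>
    define K where "K = max 1 (4 * c + 1)"
    have "\<forall>\<^sub>F r in sequentially. K powr (1 / d) \<le> real r"
      using filterlim_real_sequentially by (simp add: filterlim_at_top)
    then have "\<forall>\<^sub>F r in sequentially. 4 * c + 1 \<le> real r powr d"
    proof eventually_elim
      case (elim r)
      have "K = (K powr (1 / d)) powr d" using \<open>d > 0\<close> by (simp add: powr_powr K_def)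
      also have "\<dots> \<le> real r powr d" using elim \<open>d > 0\<close> by (intro powr_mono2) auto
      finally show ?case by (simp add: K_def)
    qed
    with c have "\<forall>\<^sub>F r :: nat in sequentially. False"
      using eventually_ge_at_top[of 1]
    proof eventually_elim
      case (elim r)
      have "ereal (real r powr (1 / \<epsilon> - 1) / 4) \<le> ereal (c * real r powr B)"
        using class_nabla_ge[OF assms elim(3)] elim(1) by (rule order_trans)
      then have "real r powr d * real r powr B \<le> (4 * c) * real r powr B"
        by (simp add: d_def flip: powr_add)
      then have "real r powr d \<le> 4 * c" using elim(3) by simp
      with elim(2) show False by linarith
    qed
    then show False by simp
  qed
qed

end
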